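(* Let $K$ be an $O$-category. Then $K$ has locally determined $\omega$-colimits of projection pairs if and only if for every $O$-category $L$ and every locally continuous functor $F : K \to L$, the induced functor $F_{\mathrm{PR}} : K_{\mathrm{PR}} \to L_{\mathrm{PR}}$ is $\omega$-cocontinuous.
   Context: An $O$-category is a category each of whose hom-sets is equipped with a partial order having least upper bounds of all $\omega$-chains $f_0 \le f_1 \le \cdots$ (a least element is not required), such that composition is monotone and preserves least upper bounds of $\omega$-chains in each argument. A functor $F : K \to L$ between $O$-categories is locally continuous when its action on each hom-set is monotone and preserves least upper bounds of $\omega$-chains. For an $O$-category $K$, a projection pair $f : A \to B$ is a pair $f = \langle f^L : A \to B,\ f^R : B \to A\rangle$ of morphisms of $K$ with $f^R \circ f^L = \mathrm{id}_A$ and $f^L \circ f^R \le \mathrm{id}_B$. The category $K_{\mathrm{PR}}$ has the objects of $K$ and, as morphisms $A \to B$, the projection pairs $A\to B$, with $(g\circ f)^L = g^L\circ f^L$ and $(g \circ f)^R = f^R \circ g^R$. A locally continuous functor $F : K \to L$ induces a functor $F_{\mathrm{PR}} : K_{\mathrm{PR}} \to L_{\mathrm{PR}}$, acting as $F$ on objects and by $F_{\mathrm{PR}} f = \langle F f^L, F f^R\rangle$ on morphisms. An $\omega$-chain of projection pairs is a functor $\Delta : (\mathbb{N},\le) \to K_{\mathrm{PR}}$. A cocone $\langle C, c\rangle$ for it consists of an object $C$ and projection pairs $c_n : \Delta_n \to C$, $n \in\mathbb{N}$, with $c_m\circ\Delta_{n\le m} = c_n$ in $K_{\mathrm{PR}}$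 for all $n \le m$; it is colimiting when it is a colimit of $\Delta$ in $K_{\mathrm{PR}}$. For any cocone, the morphisms $c_n^L\circ c_n^R : C \to C$ form an increasing $\omega$-chain in $K(C,C)$. The cocone is locally determined when $\bigvee_{n\in\mathbb{N}} c_n^L\circ c_n^R = \mathrm{id}_C$. The $O$-category $K$ has locally determined $\omega$-colimits of projection pairs when every colimiting cocone for every $\omega$-chain of projection pairs in $K$ is locally determined (the existence of colimits is not part of this definition). A functor is $\omega$-cocontinuous when it sends every colimiting cocone for an $\omega$-chain in its domain to a colimiting cocone for the image $\omega$-chain. *)

theory Defs
  imports "HOL-Algebra.Order"
begin

section \<open>Categories and functors\<close>

text \<open>
  Every arrow carries its domain and codomain. Outside \<open>Obj\<close> and \<open>Arr\<close> the fields are unspecified.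
\<close>

record ('o, 'm) cat =
  Obj :: "'o set"
  Arr :: "'m set"
  Dom :: "'m \<Rightarrow> 'o"
  Cod :: "'m \<Rightarrow> 'o"
  Ident :: "'o \<Rightarrow> 'm"
  Comp :: "'m \<Rightarrow> 'm \<Rightarrow> 'm" (infixr \<open>\<odot>\<index>\<close> 70)

definition Hom :: "('o, 'm, 'z) cat_scheme \<Rightarrow> 'o \<Rightarrow> 'o \<Rightarrow> 'm set" where
  "Hom C A B = {f \<in> Arr C. Dom C f = A \<and> Cod C f = B}"

locale category =
  fixes C :: "('o, 'm, 'z) cat_scheme" (structure)
  assumes Dom_Obj: "f \<in> Arr C \<Longrightarrow> Dom C f \<in> Obj C"
    and Cod_Obj: "f \<in> Arr C \<Longrightarrow> Cod C f \<in> Obj C"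
    and Ident_Hom: "A \<in> Obj C \<Longrightarrow> Ident C A \<in> Hom C A A"
    and Comp_Hom: "\<lbrakk>f \<in> Hom C A B; g \<in> Hom C B D\<rbrakk> \<Longrightarrow> g \<odot> f \<in> Hom C A D"
    and Comp_Ident_right: "f \<in> Hom C A B \<Longrightarrow> f \<odot> Ident C A = f"
    and Comp_Ident_left: "f \<in> Hom C A B \<Longrightarrow> Ident C B \<odot> f = f"
    and Comp_assoc: "\<lbrakk>f \<in> Hom C A B; g \<in> Hom C B D; h \<in> Hom C D E\<rbrakk>
          \<Longrightarrow> (h \<odot> g) \<odot> f = h \<odot> (g \<odot> f)"

record ('o, 'm, 'p, 'q) cat_functor =
  obj_map :: "'o \<Rightarrow> 'p"
  arr_map :: "'m \<Rightarrow> 'q"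

definition is_functor ::
    "('o, 'm, 'y) cat_scheme \<Rightarrow> ('p, 'q, 'z) cat_scheme \<Rightarrow> ('o, 'm, 'p, 'q) cat_functor \<Rightarrow> bool" where
  "is_functor C D F \<longleftrightarrow>
     (\<forall>A \<in> Obj C. obj_map F A \<in> Obj D) \<and>
     (\<forall>A \<in> Obj C. \<forall>B \<in> Obj C. \<forall>f \<in> Hom C A B. arr_map F f \<in> Hom D (obj_map F A) (obj_map F B)) \<and>
     (\<forall>A \<in> Obj C. arr_map F (Ident C A) = Ident D (obj_map F A)) \<and>
     (\<forall>f \<in> Arr C. \<forall>g \<in> Arr C. Dom C g = Cod C f \<longrightarrow>
        arr_map F (g \<odot>\<^bsub>C\<^esub> f) = arr_map F g \<odot>\<^bsub>D\<^esub> arr_map F f)"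

definition functor_comp ::
    "('p, 'q, 'r, 's) cat_functor \<Rightarrow> ('o, 'm, 'p, 'q) cat_functor \<Rightarrow> ('o, 'm, 'r, 's) cat_functor" where
  "functor_comp G F = \<lparr>obj_map = obj_map G \<circ> obj_map F, arr_map = arr_map G \<circ> arr_map F\<rparr>"


section \<open>Colimits of omega-chains\<close>

text \<open>The poset of natural numbers as a category; the arrow from \<open>n\<close> to \<open>m\<close> is the pair \<open>(n, m)\<close>.\<close>

definition omega :: "(nat, nat \<times> nat) cat" where
  "omega = \<lparr>Obj = UNIV, Arr = {(n, m). n \<le> m}, Dom = fst, Cod = snd,
            Ident = (\<lambda>n. (n, n)), Comp = (\<lambda>g f. (fst f, snd g))\<rparr>"

definition cocone ::
    "('o, 'm, 'z) cat_scheme \<Rightarrow> (nat, nat \<times> nat, 'o, 'm) cat_functor \<Rightarrow> 'o \<Rightarrow> (nat \<Rightarrow> 'm) \<Rightarrow> bool" where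
  "cocone C \<Delta> X c \<longleftrightarrow>
     X \<in> Obj C \<and> (\<forall>n. c n \<in> Hom C (obj_map \<Delta> n) X) \<and>
     (\<forall>n m. n \<le> m \<longrightarrow> c m \<odot>\<^bsub>C\<^esub> arr_map \<Delta> (n, m) = c n)"

definition colimiting ::
    "('o, 'm, 'z) cat_scheme \<Rightarrow> (nat, nat \<times> nat, 'o, 'm) cat_functor \<Rightarrow> 'o \<Rightarrow> (nat \<Rightarrow> 'm) \<Rightarrow> bool" where
  "colimiting C \<Delta> X c \<longleftrightarrow>
     cocone C \<Delta> X c \<and>
     (\<forall>Y d. cocone C \<Delta> Y d \<longrightarrow> (\<exists>!h. h \<in> Hom C X Y \<and> (\<forall>n. h \<odot>\<^bsub>C\<^esub> c n = d n)))"

definition omega_cocontinuous ::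
    "('o, 'm, 'y) cat_scheme \<Rightarrow> ('p, 'q, 'z) cat_scheme \<Rightarrow> ('o, 'm, 'p, 'q) cat_functor \<Rightarrow> bool" where
  "omega_cocontinuous C D F \<longleftrightarrow>
     (\<forall>\<Delta> X c. is_functor omega C \<Delta> \<and> colimiting C \<Delta> X c \<longrightarrow>
        colimiting D (functor_comp F \<Delta>) (obj_map F X) (\<lambda>n. arr_map F (c n)))"


section \<open>O-categories\<close>

record ('o, 'm) ocat = "('o, 'm) cat" +
  Le :: "'m \<Rightarrow> 'm \<Rightarrow> bool"

definition hom_order :: "('o, 'm, 'z) ocat_scheme \<Rightarrow> 'o \<Rightarrow> 'o \<Rightarrow> 'm gorder" where
  "hom_order K A B = \<lparr>carrier = Hom K A B, eq = (=), le = Le K\<rparr>"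

definition omega_chain :: "('a, 'z) gorder_scheme \<Rightarrow> (nat \<Rightarrow> 'a) \<Rightarrow> bool" where
  "omega_chain P f \<longleftrightarrow> (\<forall>n. f n \<in> carrier P) \<and> (\<forall>n. f n \<sqsubseteq>\<^bsub>P\<^esub> f (Suc n))"

definition is_lub :: "('a, 'z) gorder_scheme \<Rightarrow> (nat \<Rightarrow> 'a) \<Rightarrow> 'a \<Rightarrow> bool" where
  "is_lub P f s \<longleftrightarrow> least P s (Upper P (range f))"

locale O_category = category K for K :: "('o, 'm, 'z) ocat_scheme" (structure) +
  assumes hom_partial_order:
      "\<lbrakk>A \<in> Obj K; B \<in> Obj K\<rbrakk> \<Longrightarrow> partial_order (hom_order K A B)"
    and hom_omega_complete:
      "\<lbrakk>A \<in> Obj K; B \<in> Obj K; omega_chain (hom_order K A B) \<phi>\<rbrakk>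
        \<Longrightarrow> \<exists>s. is_lub (hom_order K A B) \<phi> s"
    and Comp_mono:
      "\<lbrakk>f \<in> Hom K A B; f' \<in> Hom K A B; g \<in> Hom K B C; g' \<in> Hom K B C;
        f \<sqsubseteq>\<^bsub>hom_order K A B\<^esub> f'; g \<sqsubseteq>\<^bsub>hom_order K B C\<^esub> g'\<rbrakk>
        \<Longrightarrow> g \<odot> f \<sqsubseteq>\<^bsub>hom_order K A C\<^esub> g' \<odot> f'"
    and Comp_lub_right:
      "\<lbrakk>omega_chain (hom_order K A B) \<phi>; is_lub (hom_order K A B) \<phi> s; g \<in> Hom K B C\<rbrakk>
        \<Longrightarrow> is_lub (hom_order K A C) (\<lambda>n. g \<odot> \<phi> n) (g \<odot> s)"
    and Comp_lub_left:
      "\<lbrakk>omega_chain (hom_order K B C) \<gamma>; is_lub (hom_order K B C) \<gamma> s; f \<in> Hom K A B\<rbrakk>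
        \<Longrightarrow> is_lub (hom_order K A C) (\<lambda>n. \<gamma> n \<odot> f) (s \<odot> f)"

definition locally_continuous ::
    "('o, 'm, 'y) ocat_scheme \<Rightarrow> ('p, 'q, 'z) ocat_scheme \<Rightarrow> ('o, 'm, 'p, 'q) cat_functor \<Rightarrow> bool" where
  "locally_continuous K L F \<longleftrightarrow>
     is_functor K L F \<and>
     (\<forall>A \<in> Obj K. \<forall>B \<in> Obj K.
        isotone (hom_order K A B) (hom_order L (obj_map F A) (obj_map F B)) (arr_map F) \<and>
        (\<forall>f s. omega_chain (hom_order K A B) f \<and> is_lub (hom_order K A B) f s \<longrightarrow>
           is_lub (hom_order L (obj_map F A) (obj_map F B)) (\<lambda>n. arr_map F (f n)) (arr_map F s)))"


section \<open>Projection pairs\<close>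

text \<open>A projection pair is represented as the pair of its left and right components.\<close>

definition projection_pair ::
    "('o, 'm, 'z) ocat_scheme \<Rightarrow> 'o \<Rightarrow> 'o \<Rightarrow> 'm \<times> 'm \<Rightarrow> bool" where
  "projection_pair K A B f \<longleftrightarrow>
     fst f \<in> Hom K A B \<and> snd f \<in> Hom K B A \<and>
     snd f \<odot>\<^bsub>K\<^esub> fst f = Ident K A \<and>
     fst f \<odot>\<^bsub>K\<^esub> snd f \<sqsubseteq>\<^bsub>hom_order K B B\<^esub> Ident K B"

definition PR :: "('o, 'm, 'z) ocat_scheme \<Rightarrow> ('o, 'm \<times> 'm) cat" where
  "PR K = \<lparr>Obj = Obj K,
           Arr = {f. \<exists>A \<in> Obj K. \<exists>B \<in> Obj K. projection_pair K A B f},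
           Dom = (\<lambda>f. Dom K (fst f)),
           Cod = (\<lambda>f. Cod K (fst f)),
           Ident = (\<lambda>A. (Ident K A, Ident K A)),
           Comp = (\<lambda>g f. (fst g \<odot>\<^bsub>K\<^esub> fst f, snd f \<odot>\<^bsub>K\<^esub> snd g))\<rparr>"

definition PR_functor :: "('o, 'm, 'p, 'q) cat_functor \<Rightarrow> ('o, 'm \<times> 'm, 'p, 'q \<times> 'q) cat_functor" where
  "PR_functor F = \<lparr>obj_map = obj_map F, arr_map = (\<lambda>f. (arr_map F (fst f), arr_map F (snd f)))\<rparr>"

definition locally_determined :: "('o, 'm, 'z) ocat_scheme \<Rightarrow> 'o \<Rightarrow> (nat \<Rightarrow> 'm \<times> 'm) \<Rightarrow> bool" where
  "locally_determined K X c \<longleftrightarrow>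
     is_lub (hom_order K X X) (\<lambda>n. fst (c n) \<odot>\<^bsub>K\<^esub> snd (c n)) (Ident K X)"

definition has_locally_determined_colimits :: "('o, 'm, 'z) ocat_scheme \<Rightarrow> bool" where
  "has_locally_determined_colimits K \<longleftrightarrow>
     (\<forall>\<Delta> X c. is_functor omega (PR K) \<Delta> \<and> colimiting (PR K) \<Delta> X c \<longrightarrow> locally_determined K X c)"

section \<open>Well-definedness of the constructions\<close>

lemma category_omega: "category omega"
  by unfold_locales (auto simp: omega_def Hom_def)

context O_category begin

lemma projection_pair_comp:
  assumes A: "A \<in> Obj K" "B \<in> Obj K" "D \<in> Obj K" and f: "projection_pair K A B f" and g: "projection_pair K B D g"
  shows "projection_pair K A D (fst g \<odot> fst f, snd f \<odot> snd g)"
proof -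
  have F: "fst f \<in> Hom K A B" "snd f \<in> Hom K B A" "snd f \<odot> fst f = Ident K A"
      "fst f \<odot> snd f \<sqsubseteq>\<^bsub>hom_order K B B\<^esub> Ident K B"
    and G: "fst g \<in> Hom K B D" "snd g \<in> Hom K D B" "snd g \<odot> fst g = Ident K B"
      "fst g \<odot> snd g \<sqsubseteq>\<^bsub>hom_order K D D\<^esub> Ident K D"
    using f g by (simp_all add: projection_pair_def)
  have r: "h \<sqsubseteq>\<^bsub>hom_order K X Y\<^esub> h" if "X \<in> Obj K" "Y \<in> Obj K" "h \<in> Hom K X Y" for h X Y
  proof -
    interpret Q: partial_order "hom_order K X Y" by (rule hom_partial_order[OF that(1,2)])
    show ?thesis using Q.le_refl[of h] that(3) by (simp add: hom_order_def)
  qed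
  note gf = Comp_Hom[OF F(1) G(1)] and gf' = Comp_Hom[OF G(2) F(2)]
  have "(snd f \<odot> snd g) \<odot> (fst g \<odot> fst f) = snd f \<odot> (snd g \<odot> (fst g \<odot> fst f))"
    by (rule Comp_assoc[OF gf G(2) F(2)])
  also have "snd g \<odot> (fst g \<odot> fst f) = fst f"
    using Comp_assoc[OF F(1) G(1) G(2)] G(3) Comp_Ident_left[OF F(1)] by simp
  finally have 1: "(snd f \<odot> snd g) \<odot> (fst g \<odot> fst f) = Ident K A" by (simp add: F(3))
  note ff = Comp_Hom[OF F(2) F(1)]
  have 2: "(fst g \<odot> fst f) \<odot> (snd f \<odot> snd g) = fst g \<odot> ((fst f \<odot> snd f) \<odot> snd g)"
    using Comp_assoc[OF gf' F(1) G(1)] Comp_assoc[OF G(2) F(2) F(1)] by simp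
  have 3: "(fst f \<odot> snd f) \<odot> snd g \<sqsubseteq>\<^bsub>hom_order K D B\<^esub> Ident K B \<odot> snd g"
    by (rule Comp_mono[OF G(2) G(2) ff Ident_Hom[OF A(2)] r[OF A(3,2) G(2)] F(4)])
  have 4: "fst g \<odot> ((fst f \<odot> snd f) \<odot> snd g) \<sqsubseteq>\<^bsub>hom_order K D D\<^esub> fst g \<odot> (Ident K B \<odot> snd g)"
    by (rule Comp_mono[OF Comp_Hom[OF G(2) ff] Comp_Hom[OF G(2) Ident_Hom[OF A(2)]] G(1) G(1) 3
          r[OF A(2,3) G(1)]])
  interpret P: partial_order "hom_order K D D" by (rule hom_partial_order[OF A(3) A(3)])
  have "fst g \<odot> ((fst f \<odot> snd f) \<odot> snd g) \<sqsubseteq>\<^bsub>hom_order K D D\<^esub> Ident K D"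
  proof (rule P.le_trans)
    show "fst g \<odot> ((fst f \<odot> snd f) \<odot> snd g) \<sqsubseteq>\<^bsub>hom_order K D D\<^esub> fst g \<odot> snd g"
      using 4 by (simp add: Comp_Ident_left[OF G(2)])
  qed (simp_all add: hom_order_def G(4)[unfolded hom_order_def, simplified]
        Comp_Hom[OF Comp_Hom[OF G(2) ff] G(1)] Comp_Hom[OF G(2) G(1)] Ident_Hom[OF A(3)])
  then show ?thesis using 1 2 gf gf' by (simp add: projection_pair_def)
qed

lemma projection_pair_Obj: "projection_pair K A B f \<Longrightarrow> A \<in> Obj K \<and> B \<in> Obj K"
  using Dom_Obj[of "fst f"] Cod_Obj[of "fst f"] by (auto simp: Hom_def projection_pair_def)

lemma Hom_PR: "Hom (PR K) A B = {f. projection_pair K A B f}"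
proof -
  have "Dom K (fst f) = A \<and> Cod K (fst f) = B" if "projection_pair K A B f" for f A B
    using that by (simp add: Hom_def projection_pair_def)
  then show ?thesis unfolding Hom_def[of "PR K"] using projection_pair_Obj by (simp add: PR_def) blast
qed

lemma category_PR: "category (PR K)"
proof
  fix f g h A B D E
  show "f \<in> Arr (PR K) \<Longrightarrow> Dom (PR K) f \<in> Obj (PR K)" "f \<in> Arr (PR K) \<Longrightarrow> Cod (PR K) f \<in> Obj (PR K)"
    by (auto simp: PR_def projection_pair_def Hom_def)
  show "A \<in> Obj (PR K) \<Longrightarrow> Ident (PR K) A \<in> Hom (PR K) A A"
  proof -
    assume "A \<in> Obj (PR K)"
    then have A: "A \<in> Obj K" by (simp add: PR_def)
    interpret P: partial_order "hom_order K A A" by (rule hom_partial_order[OF A A])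
    have "Ident K A \<sqsubseteq>\<^bsub>hom_order K A A\<^esub> Ident K A"
      using P.le_refl Ident_Hom[OF A] by (simp add: hom_order_def)
    then show ?thesis unfolding Hom_PR using Ident_Hom[OF A] Comp_Ident_left[OF Ident_Hom[OF A]] A
      by (auto simp: PR_def projection_pair_def)
  qed
  show "f \<in> Hom (PR K) A B \<Longrightarrow> g \<in> Hom (PR K) B D \<Longrightarrow> g \<odot>\<^bsub>PR K\<^esub> f \<in> Hom (PR K) A D"
    unfolding Hom_PR using projection_pair_comp[of A B D f g] projection_pair_Obj
    by (simp add: PR_def)
  show "f \<in> Hom (PR K) A B \<Longrightarrow> f \<odot>\<^bsub>PR K\<^esub> Ident (PR K) A = f"
    "f \<in> Hom (PR K) A B \<Longrightarrow> Ident (PR K) B \<odot>\<^bsub>PR K\<^esub> f = f"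
    unfolding Hom_PR
    by (simp_all add: PR_def projection_pair_def Comp_Ident_left[of _ A B] Comp_Ident_right[of _ A B]
        Comp_Ident_left[of _ B A] Comp_Ident_right[of _ B A])
  show "f \<in> Hom (PR K) A B \<Longrightarrow> g \<in> Hom (PR K) B D \<Longrightarrow> h \<in> Hom (PR K) D E \<Longrightarrow> (h \<odot>\<^bsub>PR K\<^esub> g) \<odot>\<^bsub>PR K\<^esub> f = h \<odot>\<^bsub>PR K\<^esub> (g \<odot>\<^bsub>PR K\<^esub> f)"
    unfolding Hom_PR
    using Comp_assoc[of "fst f" A B "fst g" D "fst h" E] Comp_assoc[of "snd h" E D "snd g" B "snd f" A]
    by (simp add: PR_def projection_pair_def)
qed
end

lemma is_functor_PR_functor:
  assumes "O_category K" "O_category L" "locally_continuous K L F"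
  shows "is_functor (PR K) (PR L) (PR_functor F)"
proof -
  interpret K: O_category K by fact
  interpret L: O_category L by fact
  have F: "is_functor K L F" using assms(3) by (simp add: locally_continuous_def)
  have O: "obj_map F A \<in> Obj L" if "A \<in> Obj K" for A using F that by (auto simp: is_functor_def)
  have H: "arr_map F f \<in> Hom L (obj_map F A) (obj_map F B)" if "f \<in> Hom K A B" for f A B
  proof -
    have "A \<in> Obj K" "B \<in> Obj K" using that K.Dom_Obj K.Cod_Obj by (auto simp: Hom_def)
    then show ?thesis using F that unfolding is_functor_def by blast
  qed
  have I: "arr_map F (Ident K A) = Ident L (obj_map F A)" if "A \<in> Obj K" for A using F that by (auto simp: is_functor_def)
  have M: "arr_map F (g \<odot>\<^bsub>K\<^esub> f) = arr_map F g \<odot>\<^bsub>L\<^esub> arr_map F f" if "f \<in> Hom K A B" "g \<in> Hom K B D" for f g A B D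
    using F that by (auto simp: is_functor_def Hom_def)
  have PP: "projection_pair L (obj_map F A) (obj_map F B) (arr_map F (fst f), arr_map F (snd f))"
    if f: "projection_pair K A B f" for A B f
  proof -
    note f' = f[unfolded projection_pair_def]
    have AB: "A \<in> Obj K" "B \<in> Obj K" using f' K.Dom_Obj K.Cod_Obj by (auto simp: Hom_def)
    have "arr_map F (fst f \<odot>\<^bsub>K\<^esub> snd f) \<sqsubseteq>\<^bsub>hom_order L (obj_map F B) (obj_map F B)\<^esub> arr_map F (Ident K B)"
      using assms(3) AB f' K.Comp_Hom[of "snd f" B A "fst f" B] K.Ident_Hom[of B]
      by (simp add: locally_continuous_def isotone_def hom_order_def)
    then show ?thesis
      using f' I[OF AB(1)] I[OF AB(2)] H[of "fst f" A B] H[of "snd f" B A]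
        M[of "fst f" A B "snd f" A] M[of "snd f" B A "fst f" B]
      by (simp add: projection_pair_def)
  qed
  have "arr_map (PR_functor F) (g \<odot>\<^bsub>PR K\<^esub> f)
      = arr_map (PR_functor F) g \<odot>\<^bsub>PR L\<^esub> arr_map (PR_functor F) f"
    if f: "f \<in> Arr (PR K)" and g: "g \<in> Arr (PR K)" and eq: "Dom (PR K) g = Cod (PR K) f" for f g
  proof -
    obtain A B where 1: "projection_pair K A B f" using f by (auto simp: PR_def)
    obtain B' D where 2: "projection_pair K B' D g" using g by (auto simp: PR_def)
    have "B' = B" using 1 2 eq by (auto simp: PR_def projection_pair_def Hom_def)
    then show ?thesis using 1 2 M[of "fst f" A B "fst g" D] M[of "snd g" D B "snd f" A]
      by (simp add: PR_functor_def PR_def projection_pair_def)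
  qed
  then show ?thesis unfolding is_functor_def K.Hom_PR L.Hom_PR using PP O I
    by (simp add: PR_functor_def PR_def)
qed

text \<open>
  A universal quantifier over all O-categories \<open>L\<close> would have to range over types. A theorem can do
  so in a positive position only, through free type variables. In a negative position \<open>L\<close> has to
  range over the O-categories on one fixed pair of types. For \<open>K :: ('o, 'm) ocat\<close> the types \<open>'m\<close> of
  objects and \<open>'m \<times> 'm \<times> 'm\<close> of arrows suffice: they hold the idempotent splitting of \<open>K\<close>.
\<close>

end

theory Submission
  imports Defs
begin

text \<open>
  A locally determined cocone \<open>c\<close> is colimiting: for a cocone \<open>d\<close> the mediating projection pair has
  components \<open>\<Squnion> d\<^sub>n\<^sup>L \<circ> c\<^sub>n\<^sup>R\<close> and \<open>\<Squnion> c\<^sub>n\<^sup>L \<circ> d\<^sub>n\<^sup>R\<close>. As locally continuous functors preserve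
  local determinacy, this gives one direction. For the other one, let \<open>c\<close> be a colimiting cocone
  with vertex \<open>X\<close>, and embed \<open>K\<close> into its idempotent splitting. The idempotent
  \<open>e = \<Squnion> c\<^sub>n\<^sup>L \<circ> c\<^sub>n\<^sup>R\<close> is an object there and the vertex of a cocone with the components of \<open>c\<close>.
  If the image of \<open>c\<close> is still colimiting, there is a mediating \<open>h\<close> from \<open>X\<close> to \<open>e\<close>; then
  \<open>h\<^sup>L \<circ> e = e\<close>, so \<open>h\<^sup>R = h\<^sup>R \<circ> e = h\<^sup>R \<circ> h\<^sup>L \<circ> e = e\<close> and \<open>h\<^sup>L = e \<circ> h\<^sup>L = h\<^sup>R \<circ> h\<^sup>L = id\<close>,
  whence \<open>e = e \<circ> h\<^sup>L = h\<^sup>L = id\<close>.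
\<close>

section \<open>Categories and functors\<close>

lemma category_Hom_Obj:
  assumes "category C" "f \<in> Hom C A B"
  shows "A \<in> Obj C" "B \<in> Obj C"
  using assms category.Dom_Obj category.Cod_Obj by (fastforce simp: Hom_def)+

lemma is_functor_obj: "is_functor C D F \<Longrightarrow> A \<in> Obj C \<Longrightarrow> obj_map F A \<in> Obj D"
  by (simp add: is_functor_def)

lemma is_functor_Hom:
  assumes "category C" "is_functor C D F" "f \<in> Hom C A B"
  shows "arr_map F f \<in> Hom D (obj_map F A) (obj_map F B)"
  using assms category_Hom_Obj[OF assms(1,3)] by (simp add: is_functor_def)

lemma is_functor_Ident:
  "is_functor C D F \<Longrightarrow> A \<in> Obj C \<Longrightarrow> arr_map F (Ident C A) = Ident D (obj_map F A)"
  by (simp add: is_functor_def)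

lemma is_functor_Comp:
  assumes "is_functor C D F" "f \<in> Hom C A B" "g \<in> Hom C B E"
  shows "arr_map F (g \<odot>\<^bsub>C\<^esub> f) = arr_map F g \<odot>\<^bsub>D\<^esub> arr_map F f"
  using assms by (simp add: is_functor_def Hom_def)

lemma is_functor_functor_comp:
  assumes "category C" "is_functor C D F" "is_functor D E G"
  shows "is_functor C E (functor_comp G F)"
proof -
  have "arr_map F f \<in> Arr D" "Dom D (arr_map F f) = obj_map F (Dom C f)"
    "Cod D (arr_map F f) = obj_map F (Cod C f)" if "f \<in> Arr C" for f
    using is_functor_Hom[OF assms(1,2), of f "Dom C f" "Cod C f"] that by (auto simp: Hom_def)
  then show ?thesis
    using assms(2,3) by (simp add: is_functor_def functor_comp_def)
qed

lemma omega_Hom [simp]: "(n, m) \<in> Hom omega n m \<longleftrightarrow> n \<le> m"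
  by (simp add: omega_def Hom_def)

lemma cocone_functor_comp:
  assumes "category C" "is_functor omega C \<Delta>" "is_functor C D F" "cocone C \<Delta> X c"
  shows "cocone D (functor_comp F \<Delta>) (obj_map F X) (\<lambda>n. arr_map F (c n))"
  unfolding cocone_def
proof (intro conjI allI impI)
  show "obj_map F X \<in> Obj D"
    using assms by (simp add: cocone_def is_functor_obj)
  show "arr_map F (c n) \<in> Hom D (obj_map (functor_comp F \<Delta>) n) (obj_map F X)" for n
    using assms is_functor_Hom[OF assms(1,3)] by (simp add: cocone_def functor_comp_def)
  show "arr_map F (c m) \<odot>\<^bsub>D\<^esub> arr_map (functor_comp F \<Delta>) (n, m) = arr_map F (c n)"
    if "n \<le> m" for n m
  proof -
    have "arr_map \<Delta> (n, m) \<in> Hom C (obj_map \<Delta> n) (obj_map \<Delta> m)"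
      using is_functor_Hom[OF category_omega assms(2)] that by simp
    moreover have "c m \<in> Hom C (obj_map \<Delta> m) X" "c m \<odot>\<^bsub>C\<^esub> arr_map \<Delta> (n, m) = c n"
      using assms(4) that by (simp_all add: cocone_def)
    ultimately show ?thesis
      using is_functor_Comp[OF assms(3)] by (fastforce simp: functor_comp_def)
  qed
qed


section \<open>Least upper bounds in O-categories\<close>

lemma hom_order_simps [simp]:
  "carrier (hom_order K A B) = Hom K A B" "le (hom_order K A B) = Le K"
  "eq (hom_order K A B) = (=)"
  by (simp_all add: hom_order_def)

text \<open>\<open>Upper\<close> disregards elements outside the carrier; the hypothesis on
  \<open>\<phi>\<close> makes every member of the sequence count.\<close>

lemma is_lub_hom_order:
  assumes "\<And>n. \<phi> n \<in> Hom K A B"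
  shows "is_lub (hom_order K A B) \<phi> s \<longleftrightarrow>
    s \<in> Hom K A B \<and> (\<forall>n. Le K (\<phi> n) s) \<and>
    (\<forall>u \<in> Hom K A B. (\<forall>n. Le K (\<phi> n) u) \<longrightarrow> Le K s u)"
  using assms by (auto simp: is_lub_def least_def Upper_def)

lemma is_lub_hom_order_Hom: "is_lub (hom_order K A B) \<phi> s \<Longrightarrow> s \<in> Hom K A B"
  by (auto simp: is_lub_def least_def Upper_def)

context O_category
begin

lemma Hom_Obj: "f \<in> Hom K A B \<Longrightarrow> A \<in> Obj K" "f \<in> Hom K A B \<Longrightarrow> B \<in> Obj K"
  using category_Hom_Obj[OF category_axioms] by blast+

lemma Le_refl: "f \<in> Hom K A B \<Longrightarrow> Le K f f"
  using hom_partial_order[of A B] partial_order.axioms(1) weak_partial_order.le_refl Hom_Obj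
  by fastforce

lemma Le_antisym:
  assumes "f \<in> Hom K A B" "g \<in> Hom K A B" "Le K f g" "Le K g f"
  shows "f = g"
proof -
  interpret partial_order "hom_order K A B"
    using hom_partial_order Hom_Obj[OF assms(1)] .
  show ?thesis using le_antisym[of f g] assms by simp
qed

lemma Le_trans:
  assumes "f \<in> Hom K A B" "g \<in> Hom K A B" "h \<in> Hom K A B" "Le K f g" "Le K g h"
  shows "Le K f h"
proof -
  interpret partial_order "hom_order K A B"
    using hom_partial_order Hom_Obj[OF assms(1)] .
  show ?thesis using le_trans[of f g h] assms by simp
qed

lemma Comp_Le:
  assumes "f \<in> Hom K A B" "f' \<in> Hom K A B" "g \<in> Hom K B C" "g' \<in> Hom K B C"
    "Le K f f'" "Le K g g'"
  shows "Le K (g \<odot> f) (g' \<odot> f')"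
  using Comp_mono[OF assms(1-4)] assms(5,6) by simp

text \<open>Morphisms are mostly proved equal below by exhibiting both as least upper bounds of one
  chain.\<close>

lemma is_lub_unique:
  assumes "is_lub (hom_order K A B) \<phi> s" "is_lub (hom_order K A B) \<phi> t"
  shows "s = t"
  using Le_antisym[of s A B t] assms by (auto simp: is_lub_def least_def Upper_def)

lemma omega_chain_le:
  assumes "omega_chain (hom_order K A B) \<phi>" "m \<le> n"
  shows "Le K (\<phi> m) (\<phi> n)"
  using assms(2)
proof (induction n rule: dec_induct)
  case base
  have "\<phi> m \<in> Hom K A B" using assms(1) by (simp add: omega_chain_def)
  then show ?case by (rule Le_refl)
next
  case (step n)
  then show ?case
    using assms(1) Le_trans[of "\<phi> m" A B "\<phi> n" "\<phi> (Suc n)"] by (simp add: omega_chain_def)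
qed

text \<open>The final value is itself a member of the chain, so every upper bound lies above it.
  Needed because composites with cocone legs become constant from some index on.\<close>

lemma is_lub_eventually_const:
  assumes "omega_chain (hom_order K A B) \<phi>" and const: "\<And>m. n \<le> m \<Longrightarrow> \<phi> m = x"
  shows "is_lub (hom_order K A B) \<phi> x"
proof -
  have H: "\<phi> m \<in> Hom K A B" for m
    using assms(1) by (simp add: omega_chain_def)
  \<comment> \<open>The index \<open>max m n\<close> is not below \<open>m\<close>, and the chain
    has already reached \<open>x\<close> there.\<close>
  have "Le K (\<phi> m) x" for m
    using omega_chain_le[OF assms(1), of m "max m n"] const[of "max m n"] by simp
  then show ?thesis
    using H H[of n] const[of n] by (simp add: is_lub_hom_order) metis
qed

lemma omega_chain_Comp_right:
  assumes "omega_chain (hom_order K A B) \<phi>" "g \<in> Hom K B C"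
  shows "omega_chain (hom_order K A C) (\<lambda>n. g \<odot> \<phi> n)"
  using assms by (auto simp: omega_chain_def intro: Comp_Hom Comp_Le Le_refl)

lemma omega_chain_Comp_left:
  assumes "omega_chain (hom_order K B C) \<phi>" "f \<in> Hom K A B"
  shows "omega_chain (hom_order K A C) (\<lambda>n. \<phi> n \<odot> f)"
  using assms by (auto simp: omega_chain_def intro: Comp_Hom Comp_Le Le_refl)


section \<open>Cocones of projection pairs\<close>

lemma projection_pairD:
  assumes "projection_pair K A B f"
  shows "fst f \<in> Hom K A B" "snd f \<in> Hom K B A" "snd f \<odot> fst f = Ident K A"
    "Le K (fst f \<odot> snd f) (Ident K B)"
  using assms by (simp_all add: projection_pair_def)

lemma PR_chainD:
  assumes "is_functor omega (PR K) \<Delta>" "n \<le> m"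
  shows "projection_pair K (obj_map \<Delta> n) (obj_map \<Delta> m) (arr_map \<Delta> (n, m))"
  using is_functor_Hom[OF category_omega assms(1), of "(n, m)" n m] assms(2) by (simp add: Hom_PR)

lemma cocone_PRD:
  assumes "cocone (PR K) \<Delta> X c"
  shows "X \<in> Obj K" "projection_pair K (obj_map \<Delta> n) X (c n)"
    "n \<le> m \<Longrightarrow> fst (c m) \<odot> fst (arr_map \<Delta> (n, m)) = fst (c n)"
    "n \<le> m \<Longrightarrow> snd (arr_map \<Delta> (n, m)) \<odot> snd (c m) = snd (c n)"
proof -
  have "n \<le> m \<Longrightarrow> c m \<odot>\<^bsub>PR K\<^esub> arr_map \<Delta> (n, m) = c n"
    using assms by (simp add: cocone_def)
  then show "n \<le> m \<Longrightarrow> fst (c m) \<odot> fst (arr_map \<Delta> (n, m)) = fst (c n)"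
    "n \<le> m \<Longrightarrow> snd (arr_map \<Delta> (n, m)) \<odot> snd (c m) = snd (c n)"
    by (auto simp: PR_def prod_eq_iff)
qed (use assms in \<open>simp_all add: cocone_def Hom_PR\<close>, simp add: PR_def)

section \<open>Comparing two cocones over one chain\<close>

context
  fixes \<Delta> X Y c d
  assumes \<Delta>: "is_functor omega (PR K) \<Delta>"
    and c: "cocone (PR K) \<Delta> X c" and d: "cocone (PR K) \<Delta> Y d"
begin

private lemma Homs:
  "fst (c n) \<in> Hom K (obj_map \<Delta> n) X" "snd (c n) \<in> Hom K X (obj_map \<Delta> n)"
  "fst (d n) \<in> Hom K (obj_map \<Delta> n) Y" "snd (d n) \<in> Hom K Y (obj_map \<Delta> n)"
  using projection_pairD(1,2)[OF cocone_PRD(2)[OF c, of n]]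
    projection_pairD(1,2)[OF cocone_PRD(2)[OF d, of n]] .

private lemma chain_Homs:
  assumes "n \<le> m"
  shows "fst (arr_map \<Delta> (n, m)) \<in> Hom K (obj_map \<Delta> n) (obj_map \<Delta> m)"
    "snd (arr_map \<Delta> (n, m)) \<in> Hom K (obj_map \<Delta> m) (obj_map \<Delta> n)"
  using projection_pairD(1,2)[OF PR_chainD[OF \<Delta> assms]] .

text \<open>Both legs at \<open>n\<close> factor through stage \<open>Suc n\<close>. This inserts
  \<open>fst ?D \<odot> snd ?D\<close>, which is below the identity, between the legs at
  \<open>Suc n\<close>. The case \<open>d = c\<close> is the chain in the definition of local
  determinacy.\<close>

lemma cocone_comp_omega_chain: "omega_chain (hom_order K X Y) (\<lambda>n. fst (d n) \<odot> snd (c n))"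
  unfolding omega_chain_def
proof (intro conjI allI)
  show "fst (d n) \<odot> snd (c n) \<in> carrier (hom_order K X Y)" for n
    using Comp_Hom[OF Homs(2,3)] by simp
  show "fst (d n) \<odot> snd (c n) \<sqsubseteq>\<^bsub>hom_order K X Y\<^esub> fst (d (Suc n)) \<odot> snd (c (Suc n))" for n
  proof -
    let ?D = "arr_map \<Delta> (n, Suc n)" and ?O = "obj_map \<Delta> (Suc n)"
    note D = projection_pairD[OF PR_chainD[OF \<Delta>, of n "Suc n", simplified]]
    note DD = Comp_Hom[OF D(2,1)]
    have I: "Ident K ?O \<in> Hom K ?O ?O"
      using Ident_Hom Hom_Obj[OF DD] by blast
    have "fst (d n) \<odot> snd (c n) = (fst (d (Suc n)) \<odot> fst ?D) \<odot> (snd ?D \<odot> snd (c (Suc n)))"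
      using cocone_PRD(4)[OF c, of n "Suc n"] cocone_PRD(3)[OF d, of n "Suc n"] by simp
    also have "\<dots> = fst (d (Suc n)) \<odot> ((fst ?D \<odot> snd ?D) \<odot> snd (c (Suc n)))"
      using Comp_assoc[OF Comp_Hom[OF Homs(2) D(2)] D(1) Homs(3)]
        Comp_assoc[OF Homs(2) D(2) D(1)] by simp
    also have "Le K \<dots> (fst (d (Suc n)) \<odot> (Ident K ?O \<odot> snd (c (Suc n))))"
      using Comp_Le[OF Comp_Hom[OF Homs(2) DD] Comp_Hom[OF Homs(2) I] Homs(3) Homs(3)
          Comp_Le[OF Homs(2) Homs(2) DD I Le_refl[OF Homs(2)] D(4)] Le_refl[OF Homs(3)]] .
    finally show ?thesis
      using Comp_Ident_left[OF Homs(2)] by simp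
  qed
qed

text \<open>Composing the chain with \<open>fst (c n)\<close> on the right makes it constantly
  \<open>fst (d n)\<close> from index \<open>n\<close> on, and composition preserves least upper
  bounds. The second claim is dual. Exchanging \<open>c\<close> and \<open>d\<close> gives the same
  facts for the right component of a mediating pair.\<close>

lemma
  assumes h: "is_lub (hom_order K X Y) (\<lambda>n. fst (d n) \<odot> snd (c n)) h"
  shows is_lub_Comp_fst: "h \<odot> fst (c n) = fst (d n)"
    and snd_Comp_is_lub: "snd (d n) \<odot> h = snd (c n)"
proof -
  let ?\<phi> = "\<lambda>m. fst (d m) \<odot> snd (c m)"
  note ch = cocone_comp_omega_chain
  have "?\<phi> m \<odot> fst (c n) = fst (d n)" if "n \<le> m" for m
  proof -
    let ?D = "arr_map \<Delta> (n, m)"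
    note D = chain_Homs[OF that]
    \<comment> \<open>The leg at \<open>n\<close> passes through stage \<open>m\<close>, where
      \<open>snd (c m)\<close> cancels \<open>fst (c m)\<close>; the left part of the chain's own
      arrow remains.\<close>
    have "snd (c m) \<odot> fst (c n) = (snd (c m) \<odot> fst (c m)) \<odot> fst ?D"
      using Comp_assoc[OF D(1) Homs(1,2)] cocone_PRD(3)[OF c that] by simp
    also have "\<dots> = fst ?D"
      using projection_pairD(3)[OF cocone_PRD(2)[OF c]] Comp_Ident_left[OF D(1)] by simp
    finally show ?thesis
      using Comp_assoc[OF Homs(1,2,3)] cocone_PRD(3)[OF d that] by simp
  qed
  then have "is_lub (hom_order K (obj_map \<Delta> n) Y) (\<lambda>m. ?\<phi> m \<odot> fst (c n)) (fst (d n))"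
    by (rule is_lub_eventually_const[OF omega_chain_Comp_left[OF ch Homs(1)]])
  with Comp_lub_left[OF ch h Homs(1)] show "h \<odot> fst (c n) = fst (d n)"
    by (rule is_lub_unique)
  have "snd (d n) \<odot> ?\<phi> m = snd (c n)" if "n \<le> m" for m
  proof -
    let ?D = "arr_map \<Delta> (n, m)"
    note D = chain_Homs[OF that]
    have "snd (d n) \<odot> fst (d m) = snd ?D \<odot> (snd (d m) \<odot> fst (d m))"
      using Comp_assoc[OF Homs(3,4) D(2)] cocone_PRD(4)[OF d that] by simp
    also have "\<dots> = snd ?D"
      using projection_pairD(3)[OF cocone_PRD(2)[OF d]] Comp_Ident_right[OF D(2)] by simp
    finally show ?thesis
      using Comp_assoc[OF Homs(2)[of m] Homs(3) Homs(4)[of n]] cocone_PRD(4)[OF c that] by simp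
  qed
  then have "is_lub (hom_order K X (obj_map \<Delta> n)) (\<lambda>m. snd (d n) \<odot> ?\<phi> m) (snd (c n))"
    by (rule is_lub_eventually_const[OF omega_chain_Comp_right[OF ch Homs(4)]])
  with Comp_lub_right[OF ch h Homs(4)] show "snd (d n) \<odot> h = snd (c n)"
    by (rule is_lub_unique)
qed

lemma is_lub_Comp_fst_snd:
  assumes e: "is_lub (hom_order K X X) (\<lambda>n. fst (c n) \<odot> snd (c n)) e"
    and cc: "omega_chain (hom_order K X X) (\<lambda>n. fst (c n) \<odot> snd (c n))"
    and h: "h \<in> Hom K X Y" "\<And>n. h \<odot> fst (c n) = fst (d n)"
  shows "is_lub (hom_order K X Y) (\<lambda>n. fst (d n) \<odot> snd (c n)) (h \<odot> e)"
proof -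
  have "h \<odot> (fst (c n) \<odot> snd (c n)) = fst (d n) \<odot> snd (c n)" for n
    using Comp_assoc[OF Homs(2,1) h(1)] h(2) by simp
  then show ?thesis
    using Comp_lub_right[OF cc e h(1)] by simp
qed

text \<open>The dual fact, for the uniqueness of right components.\<close>

lemma is_lub_fst_snd_Comp:
  assumes e: "is_lub (hom_order K X X) (\<lambda>n. fst (c n) \<odot> snd (c n)) e"
    and cc: "omega_chain (hom_order K X X) (\<lambda>n. fst (c n) \<odot> snd (c n))"
    and k: "k \<in> Hom K Y X" "\<And>n. snd (c n) \<odot> k = snd (d n)"
  shows "is_lub (hom_order K Y X) (\<lambda>n. fst (c n) \<odot> snd (d n)) (e \<odot> k)"
proof -
  have "(fst (c n) \<odot> snd (c n)) \<odot> k = fst (c n) \<odot> snd (d n)" for n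
    using Comp_assoc[OF k(1) Homs(2,1)] k(2) by simp
  then show ?thesis
    using Comp_lub_left[OF cc e k(1)] by simp
qed

end

section \<open>Local determinacy and colimits\<close>

lemma is_lub_cocone_le_Ident:
  assumes "cocone (PR K) \<Delta> X c" "is_lub (hom_order K X X) (\<lambda>n. fst (c n) \<odot> snd (c n)) e"
  shows "Le K e (Ident K X)"
proof -
  note P = projection_pairD[OF cocone_PRD(2)[OF assms(1)]]
  have H: "fst (c n) \<odot> snd (c n) \<in> Hom K X X" for n
    using Comp_Hom[OF P(2) P(1)] .
  show ?thesis
    using assms(2) P(4) Ident_Hom[OF cocone_PRD(1)[OF assms(1)]]
    unfolding is_lub_hom_order[OF H] by blast
qed

lemma locally_determined_colimiting:
  assumes \<Delta>: "is_functor omega (PR K) \<Delta>" and c: "cocone (PR K) \<Delta> X c"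
    and "locally_determined K X c"
  shows "colimiting (PR K) \<Delta> X c"
  unfolding colimiting_def
proof (intro conjI c allI impI)
  fix Y d assume d: "cocone (PR K) \<Delta> Y d"
  have id: "is_lub (hom_order K X X) (\<lambda>n. fst (c n) \<odot> snd (c n)) (Ident K X)"
    using assms(3) by (simp add: locally_determined_def)
  have XY: "X \<in> Obj K" "Y \<in> Obj K"
    using cocone_PRD(1) c d by blast+
  note cc = cocone_comp_omega_chain[OF \<Delta> c c] and dd = cocone_comp_omega_chain[OF \<Delta> d d]
  note cd = cocone_comp_omega_chain[OF \<Delta> c d] and dc = cocone_comp_omega_chain[OF \<Delta> d c]
  obtain h where h: "is_lub (hom_order K X Y) (\<lambda>n. fst (d n) \<odot> snd (c n)) h"
    using hom_omega_complete[OF XY cd] by blast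
  obtain k where k: "is_lub (hom_order K Y X) (\<lambda>n. fst (c n) \<odot> snd (d n)) k"
    using hom_omega_complete[OF XY(2,1) dc] by blast
  note hH = is_lub_hom_order_Hom[OF h] and kH = is_lub_hom_order_Hom[OF k]
  note PC = projection_pairD[OF cocone_PRD(2)[OF c]] and PD = projection_pairD[OF cocone_PRD(2)[OF d]]
  \<comment> \<open>Local determinacy enters here: \<open>k \<odot> h\<close> is the least upper
    bound of the chain of \<open>c\<close>, hence the identity. The chain of \<open>d\<close> only
    bounds \<open>h \<odot> k\<close> by the identity, which is all that a projection pair
    asks.\<close>
  have "k \<odot> (fst (d n) \<odot> snd (c n)) = fst (c n) \<odot> snd (c n)" for n
    using Comp_assoc[OF PC(2) PD(1) kH] is_lub_Comp_fst[OF \<Delta> d c k] by simp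
  then have "is_lub (hom_order K X X) (\<lambda>n. fst (c n) \<odot> snd (c n)) (k \<odot> h)"
    using Comp_lub_right[OF cd h kH] by simp
  then have kh: "k \<odot> h = Ident K X"
    using id is_lub_unique by blast
  have "h \<odot> (fst (c n) \<odot> snd (d n)) = fst (d n) \<odot> snd (d n)" for n
    using Comp_assoc[OF PD(2) PC(1) hH] is_lub_Comp_fst[OF \<Delta> c d h] by simp
  then have "is_lub (hom_order K Y Y) (\<lambda>n. fst (d n) \<odot> snd (d n)) (h \<odot> k)"
    using Comp_lub_right[OF dc k hH] by simp
  then have "Le K (h \<odot> k) (Ident K Y)"
    by (rule is_lub_cocone_le_Ident[OF d])
  with kh have pp: "projection_pair K X Y (h, k)"
    using hH kH by (simp add: projection_pair_def)
  show "\<exists>!h. h \<in> Hom (PR K) X Y \<and> (\<forall>n. h \<odot>\<^bsub>PR K\<^esub> c n = d n)"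
  proof (rule ex1I[of _ "(h, k)"])
    \<comment> \<open>On right components the condition reads
      \<open>snd (c n) \<odot> k = snd (d n)\<close>, which is \<open>snd_Comp_is_lub\<close> with
      the cocones exchanged.\<close>
    show "(h, k) \<in> Hom (PR K) X Y \<and> (\<forall>n. (h, k) \<odot>\<^bsub>PR K\<^esub> c n = d n)"
      using pp is_lub_Comp_fst[OF \<Delta> c d h] snd_Comp_is_lub[OF \<Delta> d c k]
      by (simp add: Hom_PR) (simp add: PR_def)
  next
    fix g assume g: "g \<in> Hom (PR K) X Y \<and> (\<forall>n. g \<odot>\<^bsub>PR K\<^esub> c n = d n)"
    have G: "fst g \<in> Hom K X Y" "snd g \<in> Hom K Y X"
      using g projection_pairD[of X Y g] by (simp_all add: Hom_PR)
    have eq: "fst g \<odot> fst (c n) = fst (d n)" "snd (c n) \<odot> snd g = snd (d n)" for n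
      using g by (auto simp: PR_def prod_eq_iff)
    \<comment> \<open>By local determinacy again, composing with the identity shows each component
      of \<open>g\<close> to be the least upper bound that defines \<open>h\<close> or
      \<open>k\<close>.\<close>
    have "fst g \<odot> Ident K X = h"
      using is_lub_Comp_fst_snd[OF \<Delta> c d id cc G(1) eq(1)] h is_lub_unique by blast
    moreover have "Ident K X \<odot> snd g = k"
      using is_lub_fst_snd_Comp[OF \<Delta> c d id cc G(2) eq(2)] k is_lub_unique by blast
    ultimately show "g = (h, k)"
      using Comp_Ident_right[OF G(1)] Comp_Ident_left[OF G(2)] by auto
  qed
qed

end

text \<open>Local determinacy involves only composites, an identity and the least upper bound of a
  chain, all preserved by \<open>F\<close>. The image cocone is therefore locally determined, and
  \<open>locally_determined_colimiting\<close> applies in \<open>L\<close>.\<close>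

lemma locally_continuous_cocontinuous:
  assumes "O_category K" "O_category L" and F: "locally_continuous K L F"
    and ld: "has_locally_determined_colimits K"
  shows "omega_cocontinuous (PR K) (PR L) (PR_functor F)"
  unfolding omega_cocontinuous_def
proof (intro allI impI, elim conjE)
  interpret K: O_category K by fact
  interpret L: O_category L by fact
  fix \<Delta> X c
  assume \<Delta>: "is_functor omega (PR K) \<Delta>" and "colimiting (PR K) \<Delta> X c"
  with ld have c: "cocone (PR K) \<Delta> X c"
    and id: "is_lub (hom_order K X X) (\<lambda>n. fst (c n) \<odot>\<^bsub>K\<^esub> snd (c n)) (Ident K X)"
    by (auto simp: has_locally_determined_colimits_def colimiting_def locally_determined_def)
  have isF: "is_functor K L F" using F by (simp add: locally_continuous_def)
  note isPF = is_functor_PR_functor[OF assms(1-3)]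
  note X = K.cocone_PRD(1)[OF c] and P = K.projection_pairD[OF K.cocone_PRD(2)[OF c]]
  have "is_lub (hom_order L (obj_map F X) (obj_map F X))
      (\<lambda>n. arr_map F (fst (c n) \<odot>\<^bsub>K\<^esub> snd (c n))) (arr_map F (Ident K X))"
    using F X id K.cocone_comp_omega_chain[OF \<Delta> c c] by (simp add: locally_continuous_def)
  then have "locally_determined L (obj_map F X) (\<lambda>n. arr_map (PR_functor F) (c n))"
    using is_functor_Comp[OF isF P(2,1)] is_functor_Ident[OF isF X]
    by (simp add: locally_determined_def PR_functor_def)
  moreover have "cocone (PR L) (functor_comp (PR_functor F) \<Delta>) (obj_map F X)
      (\<lambda>n. arr_map (PR_functor F) (c n))"
    using cocone_functor_comp[OF K.category_PR \<Delta> isPF c] by (simp add: PR_functor_def)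
  ultimately show "colimiting (PR L) (functor_comp (PR_functor F) \<Delta>) (obj_map (PR_functor F) X)
      (\<lambda>n. arr_map (PR_functor F) (c n))"
    using L.locally_determined_colimiting[OF is_functor_functor_comp[OF category_omega \<Delta> isPF]]
    by (simp add: PR_functor_def)
qed


section \<open>The idempotent splitting\<close>

text \<open>These are the objects of the splitting; the underlying object is recovered as
  \<open>Dom K e\<close>.\<close>

definition idempotents :: "('o, 'm, 'z) cat_scheme \<Rightarrow> 'm set" where
  "idempotents K = {e. e \<in> Hom K (Dom K e) (Dom K e) \<and> e \<odot>\<^bsub>K\<^esub> e = e}"

definition split_hom :: "('o, 'm, 'z) cat_scheme \<Rightarrow> 'm \<Rightarrow> 'm \<Rightarrow> 'm set" where
  "split_hom K d e = {f \<in> Hom K (Dom K d) (Dom K e). f \<odot>\<^bsub>K\<^esub> d = f \<and> e \<odot>\<^bsub>K\<^esub> f = f}"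

text \<open>The Karoubi envelope of \<open>K\<close>. Arrows carry both idempotents because one
  \<open>f\<close> can lie in several sets \<open>split_hom K d e\<close>. The identity of the
  object \<open>e\<close> is \<open>e\<close> itself.\<close>

definition splitting :: "('o, 'm, 'z) ocat_scheme \<Rightarrow> ('m, 'm \<times> 'm \<times> 'm) ocat" where
  "splitting K = \<lparr>Obj = idempotents K,
     Arr = {(d, f, e). d \<in> idempotents K \<and> e \<in> idempotents K \<and> f \<in> split_hom K d e},
     Dom = fst, Cod = (\<lambda>f. snd (snd f)), Ident = (\<lambda>e. (e, e, e)),
     Comp = (\<lambda>g f. (fst f, fst (snd g) \<odot>\<^bsub>K\<^esub> fst (snd f), snd (snd g))),
     Le = (\<lambda>f g. Le K (fst (snd f)) (fst (snd g)))\<rparr>"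

text \<open>The canonical embedding into the Karoubi envelope; by \<open>split_hom_Ident\<close> it
  is bijective on hom-sets.\<close>

definition split_functor :: "('o, 'm, 'z) ocat_scheme \<Rightarrow> ('o, 'm, 'm, 'm \<times> 'm \<times> 'm) cat_functor" where
  "split_functor K = \<lparr>obj_map = Ident K,
     arr_map = (\<lambda>f. (Ident K (Dom K f), f, Ident K (Cod K f)))\<rparr>"

lemma splitting_simps [simp]:
  "Obj (splitting K) = idempotents K" "Ident (splitting K) e = (e, e, e)"
  "Comp (splitting K) (d, g, e) (d', f, e') = (d', g \<odot>\<^bsub>K\<^esub> f, e)"
  "Le (splitting K) (d, f, e) (d', f', e') = Le K f f'"
  by (simp_all add: splitting_def)

lemma Hom_splitting:
  "Hom (splitting K) d e =
    (if d \<in> idempotents K \<and> e \<in> idempotents K then {(d, f, e) |f. f \<in> split_hom K d e} else {})"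
  by (auto simp: Hom_def splitting_def)

context O_category
begin

lemma idempotents_Hom: "e \<in> idempotents K \<Longrightarrow> e \<in> Hom K (Dom K e) (Dom K e)"
  by (simp add: idempotents_def)

lemma Ident_idempotent: "A \<in> Obj K \<Longrightarrow> Ident K A \<in> idempotents K"
  and Dom_Ident: "A \<in> Obj K \<Longrightarrow> Dom K (Ident K A) = A"
  using Ident_Hom[of A] Comp_Ident_left[of "Ident K A" A A] by (auto simp: idempotents_def Hom_def)

lemma split_hom_Comp:
  assumes "d \<in> idempotents K" "e \<in> idempotents K" "k \<in> idempotents K"
    "f \<in> split_hom K d e" "g \<in> split_hom K e k"
  shows "g \<odot> f \<in> split_hom K d k"
proof -
  have f: "f \<in> Hom K (Dom K d) (Dom K e)" "f \<odot> d = f"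
    and g: "g \<in> Hom K (Dom K e) (Dom K k)" "k \<odot> g = g"
    using assms(4,5) by (simp_all add: split_hom_def)
  have "(g \<odot> f) \<odot> d = g \<odot> f" "k \<odot> (g \<odot> f) = g \<odot> f"
    using Comp_assoc[OF idempotents_Hom[OF assms(1)] f(1) g(1)]
      Comp_assoc[OF f(1) g(1) idempotents_Hom[OF assms(3)]] f(2) g(2) by simp_all
  then show ?thesis
    using Comp_Hom[OF f(1) g(1)] by (simp add: split_hom_def)
qed

lemma category_splitting: "category (splitting K)"
proof
  fix d e k l f g h
  show "f \<in> Arr (splitting K) \<Longrightarrow> Dom (splitting K) f \<in> Obj (splitting K)"
    "f \<in> Arr (splitting K) \<Longrightarrow> Cod (splitting K) f \<in> Obj (splitting K)"
    by (auto simp: splitting_def)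
  show "e \<in> Obj (splitting K) \<Longrightarrow> Ident (splitting K) e \<in> Hom (splitting K) e e"
    by (simp add: Hom_splitting split_hom_def) (simp add: idempotents_def)
  show "f \<in> Hom (splitting K) d e \<Longrightarrow> g \<in> Hom (splitting K) e k \<Longrightarrow>
      g \<odot>\<^bsub>splitting K\<^esub> f \<in> Hom (splitting K) d k"
    by (auto simp: Hom_splitting split: if_splits intro: split_hom_Comp)
  show "f \<in> Hom (splitting K) d e \<Longrightarrow> f \<odot>\<^bsub>splitting K\<^esub> Ident (splitting K) d = f"
    "f \<in> Hom (splitting K) d e \<Longrightarrow> Ident (splitting K) e \<odot>\<^bsub>splitting K\<^esub> f = f"
    by (auto simp: Hom_splitting split_hom_def split: if_splits)
  show "f \<in> Hom (splitting K) d e \<Longrightarrow> g \<in> Hom (splitting K) e k \<Longrightarrow> h \<in> Hom (splitting K) k l \<Longrightarrow>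
      (h \<odot>\<^bsub>splitting K\<^esub> g) \<odot>\<^bsub>splitting K\<^esub> f = h \<odot>\<^bsub>splitting K\<^esub> (g \<odot>\<^bsub>splitting K\<^esub> f)"
    by (auto simp: Hom_splitting split_hom_def Comp_assoc split: if_splits)
qed

section \<open>Least upper bounds in the splitting\<close>

lemma omega_chain_splitting:
  assumes "omega_chain (hom_order (splitting K) d e) \<phi>"
  obtains \<psi> where "\<phi> = (\<lambda>n. (d, \<psi> n, e))" "omega_chain (hom_order K (Dom K d) (Dom K e)) \<psi>"
    "\<And>n. \<psi> n \<in> split_hom K d e" "d \<in> idempotents K" "e \<in> idempotents K"
proof -
  have H: "\<phi> n \<in> Hom (splitting K) d e" for n
    using assms by (simp add: omega_chain_def)
  \<comment> \<open>One member of the chain suffices, since a nonempty hom-set forces both ends to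
    be idempotents.\<close>
  have de: "d \<in> idempotents K" "e \<in> idempotents K"
    using H[of 0] by (simp_all add: Hom_splitting split: if_splits)
  have "\<exists>f. \<phi> n = (d, f, e) \<and> f \<in> split_hom K d e" for n
    using H[of n] de by (auto simp: Hom_splitting)
  then obtain \<psi> where \<psi>: "\<phi> n = (d, \<psi> n, e)" "\<psi> n \<in> split_hom K d e" for n
    by metis
  with assms have "omega_chain (hom_order K (Dom K d) (Dom K e)) \<psi>"
    by (simp add: omega_chain_def split_hom_def)
  with \<psi> de that show thesis by blast
qed

text \<open>Absorption passes to the limit: \<open>s \<odot> d\<close> is the least upper bound of
  \<open>\<psi> n \<odot> d = \<psi> n\<close>, so it equals \<open>s\<close>, and likewise for
  \<open>e \<odot> s\<close>. Leastness is inherited because the splitting has fewer upper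
  bounds.\<close>

lemma is_lub_splittingI:
  assumes de: "d \<in> idempotents K" "e \<in> idempotents K"
    and \<psi>: "omega_chain (hom_order K (Dom K d) (Dom K e)) \<psi>" "\<And>n. \<psi> n \<in> split_hom K d e"
    and s: "is_lub (hom_order K (Dom K d) (Dom K e)) \<psi> s"
  shows "is_lub (hom_order (splitting K) d e) (\<lambda>n. (d, \<psi> n, e)) (d, s, e)"
proof -
  have H: "\<psi> n \<in> Hom K (Dom K d) (Dom K e)" "\<psi> n \<odot> d = \<psi> n" "e \<odot> \<psi> n = \<psi> n" for n
    using \<psi>(2) by (simp_all add: split_hom_def)
  have "is_lub (hom_order K (Dom K d) (Dom K e)) \<psi> (s \<odot> d)"
    using Comp_lub_left[OF \<psi>(1) s idempotents_Hom[OF de(1)]] by (simp only: H(2))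
  moreover have "is_lub (hom_order K (Dom K d) (Dom K e)) \<psi> (e \<odot> s)"
    using Comp_lub_right[OF \<psi>(1) s idempotents_Hom[OF de(2)]] by (simp only: H(3))
  ultimately have "s \<odot> d = s" "e \<odot> s = s"
    using is_lub_unique[OF _ s] by blast+
  then have "s \<in> split_hom K d e"
    using is_lub_hom_order_Hom[OF s] by (simp add: split_hom_def)
  moreover have "(d, \<psi> n, e) \<in> Hom (splitting K) d e" for n
    using de \<psi>(2) by (simp add: Hom_splitting)
  ultimately show ?thesis
    using s de unfolding is_lub_hom_order[of \<psi>, OF H(1)]
    by (subst is_lub_hom_order) (auto simp: Hom_splitting split_hom_def)
qed

lemma partial_order_splitting: "partial_order (hom_order (splitting K) d e)"
proof
  note simps = Hom_splitting split_hom_def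
  fix x y z
  show "x \<in> carrier (hom_order (splitting K) d e) \<Longrightarrow> x \<sqsubseteq>\<^bsub>hom_order (splitting K) d e\<^esub> x"
    by (auto simp: simps intro: Le_refl split: if_splits)
  show "x \<sqsubseteq>\<^bsub>hom_order (splitting K) d e\<^esub> y \<Longrightarrow> y \<sqsubseteq>\<^bsub>hom_order (splitting K) d e\<^esub> x \<Longrightarrow>
      x \<in> carrier (hom_order (splitting K) d e) \<Longrightarrow> y \<in> carrier (hom_order (splitting K) d e) \<Longrightarrow>
      x .=\<^bsub>hom_order (splitting K) d e\<^esub> y"
    by (auto simp: simps intro: Le_antisym split: if_splits)
  show "x \<sqsubseteq>\<^bsub>hom_order (splitting K) d e\<^esub> y \<Longrightarrow> y \<sqsubseteq>\<^bsub>hom_order (splitting K) d e\<^esub> z \<Longrightarrow>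
      x \<in> carrier (hom_order (splitting K) d e) \<Longrightarrow> y \<in> carrier (hom_order (splitting K) d e) \<Longrightarrow>
      z \<in> carrier (hom_order (splitting K) d e) \<Longrightarrow> x \<sqsubseteq>\<^bsub>hom_order (splitting K) d e\<^esub> z"
    by (auto simp: simps intro: Le_trans split: if_splits)
qed auto

text \<open>Leastness among fewer upper bounds does not transfer to \<open>K\<close> directly.
  Instead \<open>K\<close> supplies a least upper bound \<open>t\<close>,
  \<open>is_lub_splittingI\<close> carries it to the splitting, and uniqueness there identifies it
  with \<open>s\<close>.\<close>

lemma is_lub_splittingD:
  assumes de: "d \<in> idempotents K" "e \<in> idempotents K"
    and \<psi>: "omega_chain (hom_order K (Dom K d) (Dom K e)) \<psi>" "\<And>n. \<psi> n \<in> split_hom K d e"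
    and s: "is_lub (hom_order (splitting K) d e) (\<lambda>n. (d, \<psi> n, e)) s"
  obtains t where "s = (d, t, e)" "is_lub (hom_order K (Dom K d) (Dom K e)) \<psi> t"
proof -
  obtain t where t: "is_lub (hom_order K (Dom K d) (Dom K e)) \<psi> t"
    using hom_omega_complete[OF _ _ \<psi>(1)] idempotents_Hom de Hom_Obj by blast
  interpret partial_order "hom_order (splitting K) d e"
    by (rule partial_order_splitting)
  have "s = (d, t, e)"
    using is_lub_splittingI[OF de \<psi> t] s unfolding is_lub_def by (rule least_unique[rotated])
  with t that show thesis by blast
qed

text \<open>Chains and least upper bounds are moved to the middle components, where the axioms of
  \<open>K\<close> apply, and then back; \<open>split_hom_Comp\<close> keeps the composites
  absorbed.\<close>

lemma O_category_splitting: "O_category (splitting K)"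
proof (intro O_category.intro category_splitting O_category_axioms.intro partial_order_splitting)
  fix d e \<phi>
  assume "omega_chain (hom_order (splitting K) d e) \<phi>"
  then show "\<exists>s. is_lub (hom_order (splitting K) d e) \<phi> s"
  proof (rule omega_chain_splitting)
    fix \<psi>
    assume \<psi>: "\<phi> = (\<lambda>n. (d, \<psi> n, e))" "omega_chain (hom_order K (Dom K d) (Dom K e)) \<psi>"
      "\<And>n. \<psi> n \<in> split_hom K d e" "d \<in> idempotents K" "e \<in> idempotents K"
    then obtain t where "is_lub (hom_order K (Dom K d) (Dom K e)) \<psi> t"
      using hom_omega_complete[OF _ _ \<psi>(2)] idempotents_Hom Hom_Obj by blast
    with \<psi> is_lub_splittingI show ?thesis by blast
  qed
next
  fix f f' g g' d e k
  assume "f \<in> Hom (splitting K) d e" "f' \<in> Hom (splitting K) d e"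
    "g \<in> Hom (splitting K) e k" "g' \<in> Hom (splitting K) e k"
    "f \<sqsubseteq>\<^bsub>hom_order (splitting K) d e\<^esub> f'" "g \<sqsubseteq>\<^bsub>hom_order (splitting K) e k\<^esub> g'"
  then show "g \<odot>\<^bsub>splitting K\<^esub> f \<sqsubseteq>\<^bsub>hom_order (splitting K) d k\<^esub> g' \<odot>\<^bsub>splitting K\<^esub> f'"
    by (auto simp: Hom_splitting split_hom_def intro: Comp_Le split: if_splits)
next
  fix d e k \<phi> s g
  assume ch: "omega_chain (hom_order (splitting K) d e) \<phi>"
    and s: "is_lub (hom_order (splitting K) d e) \<phi> s" and g: "g \<in> Hom (splitting K) e k"
  obtain \<psi> where \<psi>: "\<phi> = (\<lambda>n. (d, \<psi> n, e))" "omega_chain (hom_order K (Dom K d) (Dom K e)) \<psi>"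
    "\<And>n. \<psi> n \<in> split_hom K d e" and de: "d \<in> idempotents K" "e \<in> idempotents K"
    using ch by (rule omega_chain_splitting) blast
  obtain t where t: "s = (d, t, e)" "is_lub (hom_order K (Dom K d) (Dom K e)) \<psi> t"
    using s unfolding \<psi>(1) by (rule is_lub_splittingD[OF de \<psi>(2,3)]) blast
  obtain r where r: "g = (e, r, k)" "r \<in> split_hom K e k" and k: "k \<in> idempotents K"
    using g by (auto simp: Hom_splitting split: if_splits)
  then have rH: "r \<in> Hom K (Dom K e) (Dom K k)" by (simp add: split_hom_def)
  show "is_lub (hom_order (splitting K) d k) (\<lambda>n. g \<odot>\<^bsub>splitting K\<^esub> \<phi> n) (g \<odot>\<^bsub>splitting K\<^esub> s)"
    using is_lub_splittingI[OF de(1) k omega_chain_Comp_right[OF \<psi>(2) rH]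
        split_hom_Comp[OF de k \<psi>(3) r(2)] Comp_lub_right[OF \<psi>(2) t(2) rH]]
    by (simp add: \<psi>(1) t(1) r(1))
next
  fix d e k \<phi> s g
  assume ch: "omega_chain (hom_order (splitting K) d e) \<phi>"
    and s: "is_lub (hom_order (splitting K) d e) \<phi> s" and g: "g \<in> Hom (splitting K) k d"
  obtain \<psi> where \<psi>: "\<phi> = (\<lambda>n. (d, \<psi> n, e))" "omega_chain (hom_order K (Dom K d) (Dom K e)) \<psi>"
    "\<And>n. \<psi> n \<in> split_hom K d e" and de: "d \<in> idempotents K" "e \<in> idempotents K"
    using ch by (rule omega_chain_splitting) blast
  obtain t where t: "s = (d, t, e)" "is_lub (hom_order K (Dom K d) (Dom K e)) \<psi> t"
    using s unfolding \<psi>(1) by (rule is_lub_splittingD[OF de \<psi>(2,3)]) blast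
  obtain r where r: "g = (k, r, d)" "r \<in> split_hom K k d" and k: "k \<in> idempotents K"
    using g by (auto simp: Hom_splitting split: if_splits)
  then have rH: "r \<in> Hom K (Dom K k) (Dom K d)" by (simp add: split_hom_def)
  show "is_lub (hom_order (splitting K) k e) (\<lambda>n. \<phi> n \<odot>\<^bsub>splitting K\<^esub> g) (s \<odot>\<^bsub>splitting K\<^esub> g)"
    using is_lub_splittingI[OF k de(2) omega_chain_Comp_left[OF \<psi>(2) rH]
        split_hom_Comp[OF k de r(2) \<psi>(3)] Comp_lub_left[OF \<psi>(2) t(2) rH]]
    by (simp add: \<psi>(1) t(1) r(1))
qed

section \<open>The embedding into the splitting\<close>

lemma split_functor_obj [simp]: "obj_map (split_functor K) A = Ident K A"
  by (simp add: split_functor_def)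

lemma split_functor_arr:
  "f \<in> Hom K A B \<Longrightarrow> arr_map (split_functor K) f = (Ident K A, f, Ident K B)"
  by (simp add: split_functor_def Hom_def)

lemma split_hom_Ident:
  assumes "A \<in> Obj K" "B \<in> Obj K"
  shows "split_hom K (Ident K A) (Ident K B) = Hom K A B"
  using assms Comp_Ident_left Comp_Ident_right by (auto simp: split_hom_def Dom_Ident)

lemma is_functor_split_functor: "is_functor K (splitting K) (split_functor K)"
  unfolding is_functor_def
proof (intro conjI ballI impI)
  fix f g assume fg: "f \<in> Arr K" "g \<in> Arr K" "Dom K g = Cod K f"
  then have "f \<in> Hom K (Dom K f) (Cod K f)" "g \<in> Hom K (Cod K f) (Cod K g)"
    by (simp_all add: Hom_def)
  from this Comp_Hom[OF this]
  show "arr_map (split_functor K) (g \<odot> f) =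
      arr_map (split_functor K) g \<odot>\<^bsub>splitting K\<^esub> arr_map (split_functor K) f"
    by (simp add: split_functor_arr)
qed (simp_all add: Ident_idempotent split_functor_arr split_functor_arr[OF Ident_Hom]
    Hom_splitting split_hom_Ident)

lemma locally_continuous_split_functor: "locally_continuous K (splitting K) (split_functor K)"
  unfolding locally_continuous_def
proof (intro conjI ballI allI impI is_functor_split_functor)
  fix A B assume AB: "A \<in> Obj K" "B \<in> Obj K"
  show "isotone (hom_order K A B) (hom_order (splitting K) (obj_map (split_functor K) A)
      (obj_map (split_functor K) B)) (arr_map (split_functor K))"
    using hom_partial_order[OF AB] partial_order_splitting
    by (auto simp: isotone_def split_functor_arr dest: partial_order.axioms(1))
  fix f s assume "omega_chain (hom_order K A B) f \<and> is_lub (hom_order K A B) f s"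
  then have f: "omega_chain (hom_order K A B) f" and s: "is_lub (hom_order K A B) f s"
    by blast+
  have H: "f n \<in> Hom K A B" for n
    using f by (simp add: omega_chain_def)
  show "is_lub (hom_order (splitting K) (obj_map (split_functor K) A) (obj_map (split_functor K) B))
      (\<lambda>n. arr_map (split_functor K) (f n)) (arr_map (split_functor K) s)"
    using is_lub_splittingI[of "Ident K A" "Ident K B" f s] AB f s H
    by (simp add: Ident_idempotent Dom_Ident split_hom_Ident split_functor_arr[OF H]
        split_functor_arr[OF is_lub_hom_order_Hom[OF s]])
qed

section \<open>The idempotent of a cocone as a vertex\<close>

text \<open>As \<open>e \<odot> fst (c n) = fst (c n)\<close>, composing with \<open>e\<close>
  leaves the chain unchanged, so \<open>e \<odot> e\<close> and \<open>e\<close> are both its least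
  upper bound.\<close>

lemma cocone_is_lub_idempotent:
  assumes \<Delta>: "is_functor omega (PR K) \<Delta>" and c: "cocone (PR K) \<Delta> X c"
    and e: "is_lub (hom_order K X X) (\<lambda>n. fst (c n) \<odot> snd (c n)) e"
  shows "e \<in> idempotents K" "Dom K e = X"
proof -
  note eH = is_lub_hom_order_Hom[OF e]
  have "is_lub (hom_order K X X) (\<lambda>n. fst (c n) \<odot> snd (c n)) (e \<odot> e)"
    using is_lub_Comp_fst_snd[OF \<Delta> c c e cocone_comp_omega_chain[OF \<Delta> c c] eH
        is_lub_Comp_fst[OF \<Delta> c c e]] .
  with e eH is_lub_unique show "e \<in> idempotents K" "Dom K e = X"
    by (auto simp: idempotents_def Hom_def)
qed

text \<open>The legs are absorbed by \<open>e\<close> through \<open>is_lub_Comp_fst\<close> and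
  \<open>snd_Comp_is_lub\<close> at \<open>d = c\<close>. As \<open>e\<close> is its own identity,
  the inequality of a projection pair becomes \<open>fst (c n) \<odot> snd (c n) \<le> e\<close>,
  true because \<open>e\<close> is an upper bound.\<close>

lemma cocone_split_is_lub:
  assumes \<Delta>: "is_functor omega (PR K) \<Delta>" and c: "cocone (PR K) \<Delta> X c"
    and e: "is_lub (hom_order K X X) (\<lambda>n. fst (c n) \<odot> snd (c n)) e"
  shows "cocone (PR (splitting K)) (functor_comp (PR_functor (split_functor K)) \<Delta>) e
    (\<lambda>n. ((Ident K (obj_map \<Delta> n), fst (c n), e), (e, snd (c n), Ident K (obj_map \<Delta> n))))"
  unfolding cocone_def
proof (intro conjI allI impI)
  interpret L: O_category "splitting K" by (rule O_category_splitting)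
  note E = cocone_is_lub_idempotent[OF \<Delta> c e]
  note P = projection_pairD[OF cocone_PRD(2)[OF c]]
  show "e \<in> Obj (PR (splitting K))"
    using E by (simp add: PR_def)
  fix n
  have O: "obj_map \<Delta> n \<in> Obj K"
    using Hom_Obj(1)[OF P(1)] .
  have "fst (c n) \<in> split_hom K (Ident K (obj_map \<Delta> n)) e"
    "snd (c n) \<in> split_hom K e (Ident K (obj_map \<Delta> n))"
    using P(1,2) Comp_Ident_right[OF P(1)] Comp_Ident_left[OF P(2)]
      is_lub_Comp_fst[OF \<Delta> c c e] snd_Comp_is_lub[OF \<Delta> c c e] E Dom_Ident[OF O]
    by (simp_all add: split_hom_def)
  moreover have "Le K (fst (c n) \<odot> snd (c n)) e"
    using e Comp_Hom[OF P(2) P(1)] by (subst (asm) is_lub_hom_order) auto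
  ultimately show "((Ident K (obj_map \<Delta> n), fst (c n), e), (e, snd (c n), Ident K (obj_map \<Delta> n)))
      \<in> Hom (PR (splitting K)) (obj_map (functor_comp (PR_functor (split_functor K)) \<Delta>) n) e"
    using E P(3) Ident_idempotent[OF O]
    by (simp add: L.Hom_PR projection_pair_def Hom_splitting functor_comp_def PR_functor_def)
next
  fix n m :: nat assume nm: "n \<le> m"
  show "((Ident K (obj_map \<Delta> m), fst (c m), e), (e, snd (c m), Ident K (obj_map \<Delta> m)))
      \<odot>\<^bsub>PR (splitting K)\<^esub> arr_map (functor_comp (PR_functor (split_functor K)) \<Delta>) (n, m) =
      ((Ident K (obj_map \<Delta> n), fst (c n), e), (e, snd (c n), Ident K (obj_map \<Delta> n)))"
    using projection_pairD(1,2)[OF PR_chainD[OF \<Delta> nm]] cocone_PRD(3,4)[OF c nm]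
    by (simp add: PR_def functor_comp_def PR_functor_def split_functor_arr)
qed

lemma split_functor_cocontinuous_imp_locally_determined:
  assumes "omega_cocontinuous (PR K) (PR (splitting K)) (PR_functor (split_functor K))"
  shows "has_locally_determined_colimits K"
  unfolding has_locally_determined_colimits_def
proof (intro allI impI, elim conjE)
  interpret L: O_category "splitting K" by (rule O_category_splitting)
  fix \<Delta> X c assume \<Delta>: "is_functor omega (PR K) \<Delta>" and col: "colimiting (PR K) \<Delta> X c"
  have c: "cocone (PR K) \<Delta> X c"
    using col by (simp add: colimiting_def)
  note X = cocone_PRD(1)[OF c] and cc = cocone_comp_omega_chain[OF \<Delta> c c]
  note P = projection_pairD[OF cocone_PRD(2)[OF c]]
  obtain e where e: "is_lub (hom_order K X X) (\<lambda>n. fst (c n) \<odot> snd (c n)) e"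
    using hom_omega_complete[OF X X cc] by blast
  note E = cocone_is_lub_idempotent[OF \<Delta> c e] and eH = is_lub_hom_order_Hom[OF e]
  have "colimiting (PR (splitting K)) (functor_comp (PR_functor (split_functor K)) \<Delta>) (Ident K X)
      (\<lambda>n. arr_map (PR_functor (split_functor K)) (c n))"
    using assms \<Delta> col by (auto simp: omega_cocontinuous_def PR_functor_def)
  then obtain H where H: "projection_pair (splitting K) (Ident K X) e H"
    "\<And>n. H \<odot>\<^bsub>PR (splitting K)\<^esub> arr_map (PR_functor (split_functor K)) (c n) =
      ((Ident K (obj_map \<Delta> n), fst (c n), e), (e, snd (c n), Ident K (obj_map \<Delta> n)))"
    using cocone_split_is_lub[OF \<Delta> c e] unfolding colimiting_def L.Hom_PR by blast
  \<comment> \<open>The outer entries of the triples only record the ends; the retraction law at the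
    object \<open>Ident K X\<close> is an equation in \<open>K\<close> between middle
    entries.\<close>
  from H(1) obtain h k where hk: "H = ((Ident K X, h, e), (e, k, Ident K X))"
    "h \<in> split_hom K (Ident K X) e" "k \<in> split_hom K e (Ident K X)" "k \<odot> h = Ident K X"
    by (cases H) (auto simp: projection_pair_def Hom_splitting split: if_splits)
  have hH: "h \<in> Hom K X X" "e \<odot> h = h" and kH: "k \<in> Hom K X X" "k \<odot> e = k"
    using hk(2,3) E(2) Dom_Ident[OF X] by (simp_all add: split_hom_def)
  have "h \<odot> fst (c n) = fst (c n)" for n
    using H(2)[of n] P(1)[of n] P(2)[of n] by (simp add: hk(1) PR_def PR_functor_def split_functor_arr)
  \<comment> \<open>Since \<open>h\<close> fixes every left leg, \<open>h \<odot> e\<close> and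
    \<open>e\<close> are least upper bounds of the same chain.\<close>
  then have "h \<odot> e = e"
    using is_lub_unique[OF is_lub_Comp_fst_snd[OF \<Delta> c c e cc hH(1)] e] by simp
  then have "k = e"
    using Comp_assoc[OF eH hH(1) kH(1)] hk(4) kH(2) Comp_Ident_left[OF eH] by simp
  then have "h = Ident K X"
    using hk(4) hH(2) by simp
  then have "e = Ident K X"
    using hH(2) Comp_Ident_right[OF eH] by simp
  with e show "locally_determined K X c"
    by (simp add: locally_determined_def)
qed

end

text \<open>In the first conjunct \<open>L\<close> has the types of \<open>splitting K\<close>, so
  the converse can instantiate it there. The second conjunct gives the forward direction at
  arbitrary types; \<open>locally_continuous_cocontinuous\<close> is polymorphic in \<open>L\<close>
  and serves both.\<close>

theorem mainTheorem2:
  fixes K :: "('o, 'm) ocat"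
  assumes "O_category K"
  shows
    "(has_locally_determined_colimits K \<longleftrightarrow>
       (\<forall>(L :: ('m, 'm \<times> 'm \<times> 'm) ocat) F. O_category L \<and> locally_continuous K L F \<longrightarrow>
          omega_cocontinuous (PR K) (PR L) (PR_functor F)))
     \<and>
     (has_locally_determined_colimits K \<longrightarrow>
       (\<forall>(L :: ('p, 'q) ocat) F. O_category L \<and> locally_continuous K L F \<longrightarrow>
          omega_cocontinuous (PR K) (PR L) (PR_functor F)))"
proof (intro conjI iffI allI impI, elim conjE)
  assume all: "\<forall>(L :: ('m, 'm \<times> 'm \<times> 'm) ocat) F. O_category L \<and> locally_continuous K L F \<longrightarrow>
    omega_cocontinuous (PR K) (PR L) (PR_functor F)"
  interpret O_category K by (rule assms)
  show "has_locally_determined_colimits K"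
    using all O_category_splitting locally_continuous_split_functor
    by (intro split_functor_cocontinuous_imp_locally_determined) simp
qed (use locally_continuous_cocontinuous[OF assms] in blast)+

end
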